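(* Any indecomposable binary (rank $2$) $\mathbb Z$-lattice is not recoverable.
   Context: A $\mathbb Z$-lattice is a free $\mathbb Z$-module $L$ of finite rank with a positive definite symmetric bilinear form $B:L\times L\to\mathbb Z$ (integral valued). It is indecomposable if it is not the orthogonal direct sum of two nonzero sublattices. A $\mathbb Z$-lattice $\ell$ is represented by $L$ if there is a $\mathbb Z$-linear map $\sigma:\ell\to L$ with $B(\sigma x,\sigma y)=B(x,y)$ for all $x,y\in\ell$. A $\mathbb Z$-lattice $\ell$ is recoverable if there is a finite set $\{\ell_1,\dots,\ell_t\}$ of proper sublattices of $\ell$ such that every $\mathbb Z$-lattice (of any rank) that represents all of $\ell_1,\dots,\ell_t$ also represents $\ell$. *)

theory Defs
  imports Complex_Main "HOL-Library.Poly_Mapping"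
begin

text \<open>
  The \<open>\<int>\<close>-module structure of an abelian group. Only one of the two sums is nonempty.
\<close>

definition zscale :: "int \<Rightarrow> 'a::ab_group_add \<Rightarrow> 'a" where
  "zscale k x = (\<Sum>i<nat k. x) - (\<Sum>i<nat (- k). x)"

lemma sum_const_add: "(\<Sum>i<m + n. x) = (\<Sum>i<m. x) + (\<Sum>i<n. x :: 'a::ab_group_add)" for m n :: nat
  by (induction n) (simp_all add: algebra_simps)

lemma zscale_diff: "zscale (int m - int n) x = (\<Sum>i<m. x) - (\<Sum>i<n. x)"
proof (cases "n \<le> m")
  case True
  then obtain d where m: "m = n + d" using le_Suc_ex by blast
  show ?thesis by (simp add: zscale_def m sum_const_add)
next
  case False
  then obtain d where n: "n = m + d" using le_Suc_ex by (metis nat_le_linear)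
  show ?thesis by (simp add: zscale_def n sum_const_add)
qed

lemma int_as_diff: obtains m n where "k = int m - int n"
  using int_diff_cases by blast

lemma zscale_one: "zscale 1 x = x"
  by (simp add: zscale_def)

lemma zscale_zero: "zscale 0 x = 0"
  by (simp add: zscale_def)

lemma zscale_right_add: "zscale k (x + y) = zscale k x + zscale k y"
  by (simp add: zscale_def sum.distrib algebra_simps)

lemma zscale_left_add: "zscale (k + l) x = zscale k x + zscale l x"
proof -
  obtain m n where k: "k = int m - int n" by (rule int_as_diff)
  obtain p q where l: "l = int p - int q" by (rule int_as_diff)
  have "k + l = int (m + p) - int (n + q)" using k l by simp
  then have "zscale (k + l) x = (\<Sum>i<m + p. x) - (\<Sum>i<n + q. x)"
    using zscale_diff by metis
  also have "\<dots> = zscale k x + zscale l x"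
    by (simp add: sum_const_add k l zscale_diff algebra_simps)
  finally show ?thesis .
qed

lemma zscale_minus: "zscale (- k) x = - zscale k x"
  by (simp add: zscale_def)

lemma zscale_mult: "zscale k (zscale l x) = zscale (k * l) x"
proof -
  have nn: "zscale (int m) (zscale l x) = zscale (int m * l) x" for m
    by (induction m) (simp_all add: zscale_zero zscale_left_add zscale_one distrib_right)
  show ?thesis
    by (cases k rule: int_cases2) (simp_all add: nn zscale_minus)
qed

interpretation zmod: module "zscale :: int \<Rightarrow> 'a::ab_group_add \<Rightarrow> 'a"
  by standard (simp_all add: zscale_right_add zscale_left_add zscale_mult zscale_one)

definition zbasis :: "'a::ab_group_add set \<Rightarrow> 'a set \<Rightarrow> bool" where
  "zbasis L b \<longleftrightarrow> finite b \<and> zmod.independent b \<and> zmod.span b = L"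

definition zlinear_on :: "'a::ab_group_add set \<Rightarrow> ('a \<Rightarrow> 'b::ab_group_add) \<Rightarrow> bool" where
  "zlinear_on L f \<longleftrightarrow>
     (\<forall>x\<in>L. \<forall>y\<in>L. f (x + y) = f x + f y) \<and>
     (\<forall>k. \<forall>x\<in>L. f (zscale k x) = zscale k (f x))"

text \<open>
  A lattice is a subgroup \<open>L\<close> of an arbitrary abelian group together with a form \<open>B\<close> of which
  only the values on \<open>L \<times> L\<close> matter, so that a sublattice carries the same \<open>B\<close>.
\<close>

definition zlattice :: "'a::ab_group_add set \<Rightarrow> ('a \<Rightarrow> 'a \<Rightarrow> int) \<Rightarrow> bool" where
  "zlattice L B \<longleftrightarrow>
     (\<exists>b. zbasis L b) \<and>
     (\<forall>y\<in>L. zlinear_on L (\<lambda>x. B x y)) \<and>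
     (\<forall>x\<in>L. zlinear_on L (B x)) \<and>
     (\<forall>x\<in>L. \<forall>y\<in>L. B x y = B y x) \<and>
     (\<forall>x\<in>L. x \<noteq> 0 \<longrightarrow> B x x > 0)"

definition zrank :: "'a::ab_group_add set \<Rightarrow> nat" where
  "zrank L = card (SOME b. zbasis L b)"

definition sublattice :: "'a::ab_group_add set \<Rightarrow> 'a set \<Rightarrow> ('a \<Rightarrow> 'a \<Rightarrow> int) \<Rightarrow> bool" where
  "sublattice M L B \<longleftrightarrow> M \<subseteq> L \<and> zlattice M B"

definition orthogonal_sum ::
  "'a::ab_group_add set \<Rightarrow> ('a \<Rightarrow> 'a \<Rightarrow> int) \<Rightarrow> 'a set \<Rightarrow> 'a set \<Rightarrow> bool" where
  "orthogonal_sum L B M N \<longleftrightarrow>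
     L = {x + y | x y. x \<in> M \<and> y \<in> N} \<and> M \<inter> N = {0} \<and> (\<forall>x\<in>M. \<forall>y\<in>N. B x y = 0)"

definition indecomposable :: "'a::ab_group_add set \<Rightarrow> ('a \<Rightarrow> 'a \<Rightarrow> int) \<Rightarrow> bool" where
  "indecomposable L B \<longleftrightarrow>
     \<not> (\<exists>M N. sublattice M L B \<and> sublattice N L B \<and> M \<noteq> {0} \<and> N \<noteq> {0} \<and>
            orthogonal_sum L B M N)"

definition represented_by ::
  "'a::ab_group_add set \<Rightarrow> ('a \<Rightarrow> 'a \<Rightarrow> int) \<Rightarrow>
   'b::ab_group_add set \<Rightarrow> ('b \<Rightarrow> 'b \<Rightarrow> int) \<Rightarrow> bool" where
  "represented_by M B L C \<longleftrightarrow>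
     (\<exists>\<sigma>. zlinear_on M \<sigma> \<and> (\<forall>x\<in>M. \<sigma> x \<in> L) \<and> (\<forall>x\<in>M. \<forall>y\<in>M. C (\<sigma> x) (\<sigma> y) = B x y))"

text \<open>
  The representing lattices of arbitrary rank range over the subgroups of the free abelian group
  \<open>nat \<Rightarrow>\<^sub>0 int\<close> of countable rank, with arbitrary forms. By \<open>recoverable_any_type\<close> below, nothing
  is lost: the condition then holds for representing lattices in every abelian group.
\<close>

definition recoverable :: "'a::ab_group_add set \<Rightarrow> ('a \<Rightarrow> 'a \<Rightarrow> int) \<Rightarrow> bool" where
  "recoverable L B \<longleftrightarrow>
     (\<exists>S. finite S \<and> (\<forall>M\<in>S. sublattice M L B \<and> M \<noteq> L) \<and>
        (\<forall>(K :: (nat \<Rightarrow>\<^sub>0 int) set) C.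
           zlattice K C \<and> (\<forall>M\<in>S. represented_by M B K C) \<longrightarrow> represented_by L B K C))"

lemma represented_by_trans:
  assumes "represented_by M B L C" "represented_by L C K D"
  shows "represented_by M B K D"
proof -
  obtain f where f: "zlinear_on M f" "\<forall>x\<in>M. f x \<in> L" "\<forall>x\<in>M. \<forall>y\<in>M. C (f x) (f y) = B x y"
    using assms(1) unfolding represented_by_def by blast
  obtain g where g: "zlinear_on L g" "\<forall>x\<in>L. g x \<in> K" "\<forall>x\<in>L. \<forall>y\<in>L. D (g x) (g y) = C x y"
    using assms(2) unfolding represented_by_def by blast
  have "zlinear_on M (g \<circ> f)" using f(1,2) g(1) by (simp add: zlinear_on_def)
  then show ?thesis unfolding represented_by_def
    using f(2,3) g(2,3) by (intro exI[of _ "g \<circ> f"]) simp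
qed

lemma zlattice_isometric_copy:
  fixes L :: "'a::ab_group_add set"
  assumes L: "zlattice L B"
  obtains K :: "(nat \<Rightarrow>\<^sub>0 int) set" and C
  where "zlattice K C" "represented_by L B K C" "represented_by K C L B"
proof -
  obtain b where b: "finite b" "zmod.independent b" "zmod.span b = L"
    using L unfolding zlattice_def zbasis_def by blast
  obtain e :: "'a \<Rightarrow> nat" where e: "inj_on e b"
    using finite_imp_inj_to_nat_seg[OF b(1)] by metis
  define s where "s v = Poly_Mapping.single (e v) (1::int)" for v
  define rep where "rep = zmod.representation b"
  define \<sigma> where "\<sigma> x = (\<Sum>v\<in>b. zscale (rep x v) (s v))" for x
  have lin: "zlinear_on L \<sigma>"
    unfolding zlinear_on_def \<sigma>_def rep_def
    using b(2,3)
    by (auto simp: zmod.representation_add zmod.representation_scale zscale_left_add sum.distrib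
        zmod.scale_sum_right zscale_mult)
  have lookup_scale: "Poly_Mapping.lookup (zscale k u) n = k * Poly_Mapping.lookup u n" for k and u :: "nat \<Rightarrow>\<^sub>0 int" and n
  proof -
    have "Poly_Mapping.lookup (\<Sum>i<m. u) n = int m * Poly_Mapping.lookup u n" for m :: nat
      by (induction m) (simp_all add: lookup_add algebra_simps del: sum_constant)
    then show ?thesis
      by (cases k rule: int_cases2) (simp_all add: zscale_def lookup_minus)
  qed
  have lookup_comb: "Poly_Mapping.lookup (\<Sum>v\<in>t. zscale (c v) (s v)) (e w) = c w"
    if "t \<subseteq> b" "w \<in> t" for c t w
  proof -
    have ft: "finite t" using that(1) b(1) finite_subset by blast
    have "Poly_Mapping.lookup (\<Sum>v\<in>t. zscale (c v) (s v)) (e w) = (\<Sum>v\<in>t. c v * Poly_Mapping.lookup (s v) (e w))"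
      by (simp add: lookup_sum lookup_scale)
    also have "\<dots> = (\<Sum>v\<in>t. if v = w then c v else 0)"
      using that e by (intro sum.cong) (auto simp: s_def lookup_single when_def dest: inj_onD)
    also have "\<dots> = c w" using that ft by simp
    finally show ?thesis .
  qed
  have repsum: "(\<Sum>v\<in>b. zscale (rep x v) v) = x" if "x \<in> L" for x
    unfolding rep_def using b that by (intro zmod.sum_representation_eq) auto
  have inj: "inj_on \<sigma> L"
  proof (rule inj_onI)
    fix x y assume xy: "x \<in> L" "y \<in> L" "\<sigma> x = \<sigma> y"
    have "rep x w = rep y w" if "w \<in> b" for w
      using xy(3) lookup_comb[of b w "rep x"] lookup_comb[of b w "rep y"] that
      by (simp add: \<sigma>_def)
    then have "(\<Sum>v\<in>b. zscale (rep x v) v) = (\<Sum>v\<in>b. zscale (rep y v) v)" by simp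
    then show "x = y" using repsum xy by simp
  qed
  define K where "K = \<sigma> ` L"
  define \<tau> where "\<tau> = inv_into L \<sigma>"
  define C where "C u v = B (\<tau> u) (\<tau> v)" for u v
  have \<tau>\<sigma>: "\<tau> (\<sigma> x) = x" if "x \<in> L" for x
    using inj that by (simp add: \<tau>_def)
  have subL: "zmod.subspace L" using b(3) by (metis zmod.subspace_span)
  have addL: "x + y \<in> L" if "x \<in> L" "y \<in> L" for x y
    using subL that by (rule zmod.subspace_add)
  have scL: "zscale k x \<in> L" if "x \<in> L" for x k
    using subL that by (rule zmod.subspace_scale)
  have \<sigma>add: "\<sigma> (x + y) = \<sigma> x + \<sigma> y" if "x \<in> L" "y \<in> L" for x y
    using lin that by (simp add: zlinear_on_def)
  have \<sigma>sc: "\<sigma> (zscale k x) = zscale k (\<sigma> x)" if "x \<in> L" for x k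
    using lin that by (simp add: zlinear_on_def)
  have \<sigma>0: "\<sigma> 0 = 0"
    using \<sigma>sc[of 0 0] zmod.subspace_0[OF subL] by (simp add: zscale_zero)
  have lin\<tau>: "zlinear_on K \<tau>"
    unfolding zlinear_on_def
  proof (intro conjI ballI allI)
    fix u v assume "u \<in> K" "v \<in> K"
    then obtain x y where "x \<in> L" "y \<in> L" "u = \<sigma> x" "v = \<sigma> y" by (auto simp: K_def)
    then show "\<tau> (u + v) = \<tau> u + \<tau> v" by (metis \<sigma>add addL \<tau>\<sigma>)
  next
    fix k u assume "u \<in> K"
    then obtain x where "x \<in> L" "u = \<sigma> x" by (auto simp: K_def)
    then show "\<tau> (zscale k u) = zscale k (\<tau> u)" by (metis \<sigma>sc scL \<tau>\<sigma>)
  qed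
  have \<tau>in: "\<tau> u \<in> L" if "u \<in> K" for u using that \<tau>\<sigma> by (auto simp: K_def)
  have \<tau>nz: "\<tau> u \<noteq> 0" if "u \<in> K" "u \<noteq> 0" for u using that \<tau>\<sigma> \<sigma>0 by (auto simp: K_def)
  have injs: "inj_on s b"
  proof (rule inj_onI)
    fix v w assume "v \<in> b" "w \<in> b" "s v = s w"
    then have "Poly_Mapping.lookup (s v) (e v) = Poly_Mapping.lookup (s w) (e v)" by simp
    then have "e v = e w" by (simp add: s_def lookup_single when_def split: if_splits)
    then show "v = w" using e \<open>v \<in> b\<close> \<open>w \<in> b\<close> by (auto dest: inj_onD)
  qed
  have indep: "zmod.independent (s ` b)"
    unfolding zmod.dependent_explicit
  proof (clarify)
    fix T u v
    assume T: "finite T" "T \<subseteq> s ` b" "(\<Sum>v\<in>T. zscale (u v) v) = 0" "v \<in> T" "u v \<noteq> 0"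
    obtain t where t: "t \<subseteq> b" "T = s ` t" using T(2) by (meson subset_imageE)
    obtain w where w: "w \<in> t" "v = s w" using T(4) t by blast
    have "(\<Sum>v\<in>t. zscale (u (s v)) (s v)) = 0"
      using T(3) t sum.reindex[OF inj_on_subset[OF injs t(1)], of "\<lambda>v. zscale (u v) v"]
      by (simp add: o_def)
    then have "u (s w) = 0" using lookup_comb[OF t(1) w(1), of "\<lambda>v. u (s v)"] by simp
    then show False using T(5) w by simp
  qed
  have \<sigma>b: "\<sigma> v = s v" if "v \<in> b" for v
  proof -
    have "\<sigma> v = (\<Sum>w\<in>b. if w = v then s w else 0)"
      unfolding \<sigma>_def rep_def
      using that by (intro sum.cong) (auto simp: zmod.representation_basis[OF b(2)] zscale_one zscale_zero)
    then show ?thesis using that b(1) by simp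
  qed
  have "zmod.span (s ` b) = K"
  proof
    have "zmod.subspace K"
    proof (rule zmod.subspaceI)
      show "0 \<in> K" using \<sigma>0 zmod.subspace_0[OF subL] by (metis K_def imageI)
    next
      fix u v assume "u \<in> K" "v \<in> K"
      then obtain x y where "x \<in> L" "y \<in> L" "u = \<sigma> x" "v = \<sigma> y" by (auto simp: K_def)
      then show "u + v \<in> K" by (metis \<sigma>add addL K_def imageI)
    next
      fix k u assume "u \<in> K"
      then obtain x where "x \<in> L" "u = \<sigma> x" by (auto simp: K_def)
      then show "zscale k u \<in> K" by (metis \<sigma>sc scL K_def imageI)
    qed
    moreover have "s ` b \<subseteq> K"
    proof
      fix u assume "u \<in> s ` b"
      then obtain v where v: "v \<in> b" "u = s v" by blast
      have "v \<in> L" using zmod.span_base[OF v(1)] b(3) by simp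
      then show "u \<in> K" using v \<sigma>b[OF v(1)] by (metis K_def imageI)
    qed
    ultimately show "zmod.span (s ` b) \<subseteq> K" by (rule zmod.span_minimal[rotated])
    show "K \<subseteq> zmod.span (s ` b)"
      by (auto simp: K_def \<sigma>_def intro!: zmod.span_sum zmod.span_scale intro: zmod.span_base)
  qed
  then have basis: "zbasis K (s ` b)" using b(1) indep by (simp add: zbasis_def)
  have "zlattice K C"
    unfolding zlattice_def
  proof (intro conjI)
    show "\<exists>b. zbasis K b" using basis by blast
    show "\<forall>y\<in>K. zlinear_on K (\<lambda>x. C x y)" "\<forall>x\<in>K. zlinear_on K (C x)"
      using L lin\<tau> \<tau>in by (simp_all add: zlinear_on_def zlattice_def C_def)
    show "\<forall>x\<in>K. \<forall>y\<in>K. C x y = C y x" "\<forall>x\<in>K. x \<noteq> 0 \<longrightarrow> C x x > 0"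
      using L \<tau>in \<tau>nz by (simp_all add: zlattice_def C_def)
  qed
  moreover have "represented_by L B K C"
    unfolding represented_by_def using lin \<tau>\<sigma> by (intro exI[of _ \<sigma>]) (auto simp: K_def C_def)
  moreover have "represented_by K C L B"
    unfolding represented_by_def using lin\<tau> \<tau>in by (intro exI[of _ \<tau>]) (auto simp: C_def)
  ultimately show ?thesis using that by blast
qed

lemma recoverable_any_type:
  assumes "recoverable L B"
  shows "\<exists>S. finite S \<and> (\<forall>M\<in>S. sublattice M L B \<and> M \<noteq> L) \<and>
    (\<forall>(K :: 'b::ab_group_add set) C.
       zlattice K C \<and> (\<forall>M\<in>S. represented_by M B K C) \<longrightarrow> represented_by L B K C)"
proof -
  obtain S where S: "finite S" "\<forall>M\<in>S. sublattice M L B \<and> M \<noteq> L"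
    and rep: "\<And>(K :: (nat \<Rightarrow>\<^sub>0 int) set) C.
       zlattice K C \<Longrightarrow> \<forall>M\<in>S. represented_by M B K C \<Longrightarrow> represented_by L B K C"
    using assms unfolding recoverable_def by metis
  have "represented_by L B K C"
    if K: "zlattice K C" "\<forall>M\<in>S. represented_by M B K C" for K :: "'b set" and C
  proof -
    obtain K' :: "(nat \<Rightarrow>\<^sub>0 int) set" and C'
      where K': "zlattice K' C'" "represented_by K C K' C'" "represented_by K' C' K C"
      using zlattice_isometric_copy[OF K(1)] .
    have "\<forall>M\<in>S. represented_by M B K' C'" using K(2) K'(2) represented_by_trans by blast
    then have "represented_by L B K' C'" using rep K'(1) by blast
    then show ?thesis using K'(3) represented_by_trans by blast
  qed
  then show ?thesis using S by blast
qed

end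

theory Submission
  imports Defs "HOL-Library.Function_Algebras"
begin

text \<open>
  Let \<open>x, y\<close> be a reduced basis of the lattice, with Gram matrix \<open>(a, b; b, c)\<close>, where \<open>a\<close> is the
  minimum and \<open>2\<bar>b\<bar> \<le> a\<close>; indecomposability means \<open>b \<noteq> 0\<close>. The orthogonal sum of
  any given proper sublattices represents each of them. Suppose it also represents the whole lattice.
  Each nonzero component of the image of \<open>x\<close> has norm at least \<open>a\<close>, so there is only one, \<open>u\<close>, in some
  summand \<open>M\<close>, and it has norm \<open>a\<close>. The component \<open>v\<close> in \<open>M\<close> of the image of \<open>y\<close> satisfies
  \<open>B u v = b\<close> and \<open>B v v \<le> c\<close>. The Gram determinant of \<open>u, v\<close> is therefore at most that of \<open>x, y\<close>,
  but it is also \<open>n\<^sup>2\<close> times the latter for an integer \<open>n\<close>. If \<open>n = \<plusminus>1\<close>, then \<open>u, v\<close> generate the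
  whole lattice, so \<open>M\<close> is not proper. If \<open>n = 0\<close>, then \<open>a (B v v) = b\<^sup>2 < a\<^sup>2\<close> with \<open>v \<noteq> 0\<close>, which
  contradicts the minimality of \<open>a\<close>.
\<close>

section \<open>Additive maps and bases\<close>

text \<open>\<open>zscale\<close> is repeated addition and subtraction, so additivity alone already
  forces compatibility with integer multiples.\<close>

lemma zscale_additive:
  assumes "\<And>x y. h (x + y) = h x + h y"
  shows "h (zscale k x) = zscale k (h x)"
proof -
  have 0: "h 0 = 0" using assms[of 0 0] by simp
  have n: "h (zscale (int m) x) = zscale (int m) (h x)" for m
    by (induction m) (simp_all add: 0 assms zscale_zero zscale_left_add zscale_one)
  have neg: "h (- z) = - h z" for z
    using assms[of z "- z"] 0 by (simp add: eq_neg_iff_add_eq_0 add.commute)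
  show ?thesis
    by (cases k rule: int_cases2) (simp_all add: n neg zscale_minus)
qed

lemma zscale_int: "zscale k (n :: int) = k * n"
  by (cases k rule: int_cases2) (simp_all add: zscale_def)

lemma zscale_fun_apply: "zscale k f i = zscale k (f i)"
  by (rule zscale_additive[of "\<lambda>f. f i"]) simp

text \<open>A linear relation over the union splits into a part in \<open>A\<close> and a part in
  \<open>A'\<close> with sum zero. Each part then lies in the trivial intersection, so both vanish
  separately.\<close>

lemma zbasis_Un:
  assumes A: "zbasis A b" and A': "zbasis A' b'" and disj: "A \<inter> A' = {0}"
  shows "zbasis {x + y |x y. x \<in> A \<and> y \<in> A'} (b \<union> b')"
  unfolding zbasis_def
proof (intro conjI)
  have fin: "finite b" "finite b'"
    and ind: "zmod.independent b" "zmod.independent b'"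
    and span: "zmod.span b = A" "zmod.span b' = A'"
    using A A' by (auto simp: zbasis_def)
  show "finite (b \<union> b')" using fin by simp
  show "zmod.span (b \<union> b') = {x + y |x y. x \<in> A \<and> y \<in> A'}"
    by (simp add: zmod.span_Un span)
  \<comment> \<open>Disjointness of the two bases is what lets the sum over their union split as
    \<open>s + s'\<close>.\<close>
  have "0 \<notin> b" using ind(1) zmod.dependent_zero by blast
  moreover have "b \<inter> b' \<subseteq> {0}"
    unfolding disj[symmetric] span[symmetric] by (intro Int_mono zmod.span_superset)
  ultimately have bb: "b \<inter> b' = {}" by blast
  show "zmod.independent (b \<union> b')"
  proof
    assume "zmod.dependent (b \<union> b')"
    then obtain u where u: "\<exists>v\<in>b \<union> b'. u v \<noteq> 0" "(\<Sum>v\<in>b \<union> b'. zscale (u v) v) = 0"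
      using zmod.dependent_finite[of "b \<union> b'"] fin by auto
    define s s' where "s = (\<Sum>v\<in>b. zscale (u v) v)" and "s' = (\<Sum>v\<in>b'. zscale (u v) v)"
    have sum: "s + s' = 0" using u(2) fin bb by (simp add: s_def s'_def sum.union_disjoint)
    have s: "s \<in> A" "s' \<in> A'"
      unfolding s_def s'_def span[symmetric]
      by (auto intro!: zmod.span_sum zmod.span_scale intro: zmod.span_base)
    have "s = - s'" using sum by (simp add: eq_neg_iff_add_eq_0)
    moreover have "- s' \<in> A'" using s(2) span(2) zmod.span_neg by metis
    ultimately have "s \<in> A \<inter> A'" using s(1) by simp
    then have "s = 0" using disj by blast
    then have "s' = 0" using sum by simp
    with \<open>s = 0\<close> have "\<forall>v\<in>b. u v = 0" "\<forall>v\<in>b'. u v = 0"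
      using ind fin zmod.dependent_finite[of b] zmod.dependent_finite[of b']
      unfolding s_def s'_def by auto
    then show False using u(1) by auto
  qed
qed

lemma zbasis_image:
  assumes "zbasis A b" and add: "\<And>x y. h (x + y) = h x + h y" and inj: "inj_on h A"
  shows "zbasis (h ` A) (h ` b)"
proof -
  interpret h: module_hom zscale zscale h
    by (simp add: module_hom_iff zmod.module_axioms add zscale_additive)
  show ?thesis
    using assms(1) inj h.independent_injective_image[of b] h.span_image[of b]
    by (auto simp: zbasis_def)
qed

section \<open>Orthogonal sums\<close>

text \<open>Functions are required to vanish outside \<open>I\<close>, so that an element is
  determined by its coordinates in \<open>I\<close> and the summed form stays positive
  definite.\<close>

definition direct_sum :: "'i set \<Rightarrow> ('i \<Rightarrow> 'a::zero set) \<Rightarrow> ('i \<Rightarrow> 'a) set" where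
  "direct_sum I A = {f. (\<forall>i\<in>I. f i \<in> A i) \<and> (\<forall>i. i \<notin> I \<longrightarrow> f i = 0)}"

text \<open>Peels off one summand as a subgroup supported at \<open>i\<close>, the shape that
  \<open>zbasis_Un\<close> needs in the induction on \<open>I\<close>.\<close>

lemma direct_sum_insert:
  fixes A :: "'i \<Rightarrow> 'a::ab_group_add set"
  assumes "i \<notin> I"
  shows "direct_sum (insert i I) A
    = {f + g |f g. f \<in> direct_sum I A \<and> g \<in> (\<lambda>x j. if j = i then x else 0) ` A i}"
proof (intro equalityI subsetI)
  fix f assume f: "f \<in> direct_sum (insert i I) A"
  have "f = f(i := 0) + (\<lambda>j. if j = i then f i else 0)" by (auto simp: fun_eq_iff)
  moreover have "f(i := 0) \<in> direct_sum I A" "f i \<in> A i"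
    using f assms by (auto simp: direct_sum_def)
  ultimately show "f \<in> {f + g |f g. f \<in> direct_sum I A \<and> g \<in> (\<lambda>x j. if j = i then x else 0) ` A i}"
    by blast
qed (use assms in \<open>auto simp: direct_sum_def\<close>)

lemma direct_sum_basis:
  fixes A :: "'i \<Rightarrow> 'a::ab_group_add set"
  assumes "finite I" "\<And>i. i \<in> I \<Longrightarrow> \<exists>b. zbasis (A i) b"
  shows "\<exists>b. zbasis (direct_sum I A) b"
  using assms
proof (induction I rule: finite_induct)
  case empty
  have "direct_sum {} A = {0}" by (auto simp: direct_sum_def fun_eq_iff)
  moreover have "zbasis {0} {}" by (simp add: zbasis_def zmod.independent_empty)
  ultimately show ?case by (metis (lifting))
next
  case (insert i I)
  obtain b where b: "zbasis (direct_sum I A) b" using insert by auto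
  obtain b' where b': "zbasis (A i) b'" using insert.prems by auto
  let ?h = "\<lambda>(x::'a) j. if j = i then x else 0"
  have "zbasis (?h ` A i) (?h ` b')"
    by (rule zbasis_image[OF b']) (auto simp: fun_eq_iff inj_on_def)
  moreover have "direct_sum I A \<inter> ?h ` A i = {0}"
  proof -
    have "0 \<in> direct_sum I A" "0 \<in> A i"
      using b b' zmod.span_zero[of b] zmod.span_zero[of b'] by (simp_all add: zbasis_def)
    moreover have "0 \<in> ?h ` A i"
      by (rule image_eqI[OF _ \<open>0 \<in> A i\<close>]) (simp add: fun_eq_iff)
    moreover have "f = 0" if "f \<in> direct_sum I A \<inter> ?h ` A i" for f
      using that insert.hyps by (fastforce simp: direct_sum_def)
    ultimately show ?thesis by auto
  qed
  ultimately show ?case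
    unfolding direct_sum_insert[OF insert.hyps(2)] using zbasis_Un[OF b] by blast
qed

lemma zlattice_direct_sum:
  fixes A :: "'i \<Rightarrow> 'a::ab_group_add set"
  assumes fin: "finite I" and lat: "\<And>i. i \<in> I \<Longrightarrow> zlattice (A i) B"
  shows "zlattice (direct_sum I A) (\<lambda>f g. \<Sum>i\<in>I. B (f i) (g i))"
  unfolding zlattice_def
proof (intro conjI)
  show "\<exists>b. zbasis (direct_sum I A) b"
    by (rule direct_sum_basis[OF fin]) (use lat in \<open>auto simp: zlattice_def\<close>)
  show "\<forall>g\<in>direct_sum I A. zlinear_on (direct_sum I A) (\<lambda>f. \<Sum>i\<in>I. B (f i) (g i))"
    "\<forall>f\<in>direct_sum I A. zlinear_on (direct_sum I A) (\<lambda>g. \<Sum>i\<in>I. B (f i) (g i))"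
    using lat
    by (simp_all add: zlattice_def zlinear_on_def direct_sum_def zscale_fun_apply zscale_int
        sum.distrib sum_distrib_left)
  show "\<forall>f\<in>direct_sum I A. \<forall>g\<in>direct_sum I A. (\<Sum>i\<in>I. B (f i) (g i)) = (\<Sum>i\<in>I. B (g i) (f i))"
    using lat by (auto simp: zlattice_def direct_sum_def intro!: sum.cong)
  show "\<forall>f\<in>direct_sum I A. f \<noteq> 0 \<longrightarrow> (\<Sum>i\<in>I. B (f i) (f i)) > 0"
  proof (intro ballI impI)
    fix f assume f: "f \<in> direct_sum I A" "f \<noteq> 0"
    have Bpos: "B (f i) (f i) > 0" if "i \<in> I" "f i \<noteq> 0" for i
      using lat[OF that(1)] f(1) that by (simp add: zlattice_def direct_sum_def)
    \<comment> \<open>The form is arbitrary off the lattices, so its value at zero must come from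
      additivity inside some \<open>A i\<close>.\<close>
    have B0: "B 0 0 = 0" if "i \<in> I" "f i = 0" for i
    proof -
      have "0 \<in> A i" using f(1) that by (auto simp: direct_sum_def)
      then have "B (0 + 0) 0 = B 0 0 + B 0 0"
        using lat[OF that(1)] unfolding zlattice_def zlinear_on_def by blast
      then show ?thesis by simp
    qed
    obtain i where "f i \<noteq> 0" "i \<in> I" using f by (auto simp: direct_sum_def fun_eq_iff)
    then show "(\<Sum>i\<in>I. B (f i) (f i)) > 0"
      using fin Bpos B0 by (intro sum_pos2[of I i]) (auto, metis less_imp_le order_refl)
  qed
qed

section \<open>Computing with the form on integer combinations\<close>

lemma zlattice_add: "zlattice L B \<Longrightarrow> x \<in> L \<Longrightarrow> y \<in> L \<Longrightarrow> x + y \<in> L"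
  unfolding zlattice_def zbasis_def by (metis zmod.span_add)

lemma zlattice_scale: "zlattice L B \<Longrightarrow> x \<in> L \<Longrightarrow> zscale k x \<in> L"
  unfolding zlattice_def zbasis_def by (metis zmod.span_scale)

lemma zlattice_zero: "zlattice L B \<Longrightarrow> 0 \<in> L"
  unfolding zlattice_def zbasis_def by (metis zmod.span_zero)

lemma form_comb:
  assumes L: "zlattice L B" and "x \<in> L" "y \<in> L"
  shows "B (zscale p x + zscale q y) (zscale r x + zscale s y)
    = p * r * B x x + (p * s + q * r) * B x y + q * s * B y y"
proof -
  have mem: "zscale k x \<in> L" "zscale k y \<in> L" "zscale k x + zscale l y \<in> L" for k l
    using assms by (simp_all add: zlattice_scale zlattice_add)
  have sym: "B y x = B x y" using assms by (simp add: zlattice_def)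
  have add: "B (u + v) w = B u w + B v w" "B w (u + v) = B w u + B w v"
    if "u \<in> L" "v \<in> L" "w \<in> L" for u v w
    using L that by (simp_all add: zlattice_def zlinear_on_def)
  have sc: "B (zscale k u) w = k * B u w" "B w (zscale k u) = k * B w u"
    if "u \<in> L" "w \<in> L" for u w k
    using L that by (simp_all add: zlattice_def zlinear_on_def zscale_int)
  show ?thesis
    by (simp add: add sc mem assms sym) (simp add: algebra_simps)
qed

lemma form_zero:
  assumes "zlattice L B" "x \<in> L"
  shows "B 0 x = 0" "B x 0 = 0"
  using form_comb[OF assms assms(2), of 0 0 1 0] form_comb[OF assms assms(2), of 1 0 0 0]
  by (simp_all add: zscale_zero zscale_one)

text \<open>The representation places a vector in coordinate \<open>i\<close> and zeros
  elsewhere.\<close>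

lemma represented_by_direct_sum:
  assumes fin: "finite I" and lat: "\<And>i. i \<in> I \<Longrightarrow> zlattice (A i) B" and i: "i \<in> I"
  shows "represented_by (A i) B (direct_sum I A) (\<lambda>f g. \<Sum>i\<in>I. B (f i) (g i))"
  unfolding represented_by_def
proof (intro exI conjI ballI)
  let ?h = "\<lambda>x j. if j = i then x else 0"
  show "zlinear_on (A i) ?h"
    by (auto simp: zlinear_on_def fun_eq_iff zscale_fun_apply)
  fix x assume x: "x \<in> A i"
  show "?h x \<in> direct_sum I A"
    using i x lat zlattice_zero by (auto simp: direct_sum_def)
  fix y assume y: "y \<in> A i"
  have "B 0 0 = 0" using form_zero(1) lat[OF i] zlattice_zero by blast
  then have "(\<Sum>j\<in>I. B (?h x j) (?h y j)) = (\<Sum>j\<in>I. if j = i then B x y else 0)"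
    by (intro sum.cong) auto
  then show "(\<Sum>j\<in>I. B (?h x j) (?h y j)) = B x y" using fin i by simp
qed

section \<open>Reduced bases of binary lattices\<close>

text \<open>An ordered basis with explicit coefficients, which makes exchanging and shearing the two
  vectors easy to state.\<close>

definition basis_pair :: "'a::ab_group_add set \<Rightarrow> 'a \<Rightarrow> 'a \<Rightarrow> bool" where
  "basis_pair L x y \<longleftrightarrow> L = {zscale m x + zscale n y |m n. True} \<and>
     (\<forall>m n. zscale m x + zscale n y = 0 \<longrightarrow> m = 0 \<and> n = 0)"

lemma zrank_2_basis_pair:
  assumes "zlattice L B" "zrank L = 2"
  obtains x y where "basis_pair L x y"
proof -
  \<comment> \<open>\<open>zrank\<close> measures this very choice of basis, so no invariance of
    rank has to be invoked.\<close>
  define b where "b = (SOME b. zbasis L b)"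
  have b: "zbasis L b" unfolding b_def using assms(1) by (metis someI_ex zlattice_def)
  have "card b = 2" using assms(2) by (simp add: zrank_def b_def)
  then obtain x y where xy: "b = {x, y}" "x \<noteq> y" by (meson card_2_iff)
  have "L = {zscale m x + zscale n y |m n. True}"
  proof -
    have "L = zmod.span ({x} \<union> {y})" using b xy by (simp add: zbasis_def insert_commute)
    then show ?thesis unfolding zmod.span_Un zmod.span_singleton by auto
  qed
  moreover have "m = 0 \<and> n = 0" if "zscale m x + zscale n y = 0" for m n
  proof (rule ccontr)
    assume "\<not> (m = 0 \<and> n = 0)"
    then have "zmod.dependent {x, y}"
      using that xy(2)
      by (subst zmod.dependent_finite) (auto intro!: exI[of _ "\<lambda>v. if v = x then m else n"])
    then show False using b xy by (simp add: zbasis_def)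
  qed
  ultimately have "basis_pair L x y" unfolding basis_pair_def by blast
  then show ?thesis by (rule that)
qed

lemma basis_pair_mem:
  assumes "basis_pair L x y"
  shows "x \<in> L" "y \<in> L"
proof -
  have "x = zscale 1 x + zscale 0 y" "y = zscale 0 x + zscale 1 y"
    by (simp_all add: zscale_one zscale_zero)
  then show "x \<in> L" "y \<in> L" using assms unfolding basis_pair_def by blast+
qed

lemma basis_pair_swap: "basis_pair L x y \<Longrightarrow> basis_pair L y x"
  unfolding basis_pair_def by (auto simp: add.commute) (metis add.commute)+

text \<open>The coefficient change from \<open>m\<close> to \<open>m + n * k\<close> is invertible
  over the integers.\<close>

lemma basis_pair_shear:
  assumes "basis_pair L x y"
  shows "basis_pair L x (y + zscale k x)"
proof -
  have eq: "zscale m x + zscale n (y + zscale k x) = zscale (m + n * k) x + zscale n y" for m n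
    by (simp add: zscale_left_add zscale_right_add zscale_mult algebra_simps)
  have "zscale m x + zscale n y = zscale (m - n * k) x + zscale n (y + zscale k x)" for m n
    by (simp add: eq)
  then have "{zscale m x + zscale n (y + zscale k x) |m n. True} = {zscale m x + zscale n y |m n. True}"
    using eq by blast
  moreover have "m = 0 \<and> n = 0" if "zscale m x + zscale n (y + zscale k x) = 0" for m n
  proof -
    have "m + n * k = 0 \<and> n = 0"
      using that assms unfolding eq basis_pair_def by blast
    then show ?thesis by auto
  qed
  ultimately show ?thesis using assms unfolding basis_pair_def by simp
qed

text \<open>Bounding the cross term by \<open>\<bar>m * n\<bar> * a\<close> and \<open>c\<close>
  below by \<open>a\<close> leaves \<open>a\<close> times
  \<open>m * m + n * n - \<bar>m * n\<bar>\<close>, which is a positive integer.\<close>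

lemma reduced_form_ge:
  fixes a b c m n :: int
  assumes "2 * \<bar>b\<bar> \<le> a" "a \<le> c" "m \<noteq> 0 \<or> n \<noteq> 0"
  shows "a \<le> m * m * a + 2 * m * n * b + n * n * c"
proof -
  have a: "0 \<le> a" using assms(1) by linarith
  have "\<bar>2 * (m * n) * b\<bar> = \<bar>m * n\<bar> * (2 * \<bar>b\<bar>)" by (simp add: abs_mult)
  also have "\<dots> \<le> \<bar>m * n\<bar> * a" using assms(1) by (simp add: mult_left_mono)
  finally have 1: "- (\<bar>m * n\<bar> * a) \<le> 2 * m * n * b" by (simp add: algebra_simps abs_le_iff)
  have 2: "n * n * a \<le> n * n * c" using assms(2) by (simp add: mult_left_mono)
  have 3: "1 \<le> m * m + n * n - \<bar>m * n\<bar>"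
  proof (cases "m = 0 \<or> n = 0")
    case True
    then show ?thesis
      using assms(3) by (auto simp: int_one_le_iff_zero_less zero_less_mult_iff)
  next
    case False
    then have "\<bar>m\<bar> * \<bar>n\<bar> \<ge> 1" by (simp add: int_one_le_iff_zero_less)
    moreover have "m * m + n * n - 2 * (\<bar>m\<bar> * \<bar>n\<bar>) = (\<bar>m\<bar> - \<bar>n\<bar>) * (\<bar>m\<bar> - \<bar>n\<bar>)"
      by (simp add: algebra_simps)
    moreover have "0 \<le> (\<bar>m\<bar> - \<bar>n\<bar>) * (\<bar>m\<bar> - \<bar>n\<bar>)" by simp
    ultimately show ?thesis by (simp only: abs_mult)
  qed
  have "1 * a \<le> (m * m + n * n - \<bar>m * n\<bar>) * a" using 3 a by (rule mult_right_mono)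
  then show ?thesis using 1 2 by (simp add: algebra_simps)
qed

text \<open>Lagrange reduction by an extremal choice: among all bases take one with
  \<open>B x x + B y y\<close> least, ordered so that \<open>x\<close> is the shorter
  vector.\<close>

lemma reduced_basis:
  assumes L: "zlattice L B" and rk: "zrank L = 2"
  obtains x y where "basis_pair L x y" "2 * \<bar>B x y\<bar> \<le> B x x"
    "\<And>z. z \<in> L \<Longrightarrow> z \<noteq> 0 \<Longrightarrow> B x x \<le> B z z"
proof -
  define P where "P = (\<lambda>(x, y). basis_pair L x y)"
  \<comment> \<open>Norms are nonnegative on \<open>L\<close>, so \<open>nat\<close> truncates
    nothing on basis pairs.\<close>
  define w where "w = (\<lambda>(x, y). nat (B x x + B y y))"
  obtain x0 y0 where "P (x0, y0)" using zrank_2_basis_pair[OF L rk] by (auto simp: P_def)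
  then obtain p where p: "P p" "\<And>q. P q \<Longrightarrow> w p \<le> w q"
    using ex_has_least_nat[of P _ w] by blast
  obtain x' y' where p': "p = (x', y')" by (cases p)
  obtain x y where xy: "basis_pair L x y" "B x x \<le> B y y" "w (x, y) = w p"
  proof (cases "B x' x' \<le> B y' y'")
    case True
    then show ?thesis using that p p' by (auto simp: P_def)
  next
    case False
    then show ?thesis
      using that[of y' x'] p p' by (auto simp: P_def w_def add.commute basis_pair_swap)
  qed
  have mem: "x \<in> L" "y \<in> L" using basis_pair_mem xy(1) by blast+
  have nonneg: "0 \<le> B z z" if "z \<in> L" for z
    using L that form_zero[OF L that] unfolding zlattice_def by (metis less_imp_le order_refl)
  have shear: "B y y \<le> B y y + 2 * k * B x y + k * k * B x x" for k
  proof -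
    have z: "y + zscale k x \<in> L" using mem L by (simp add: zlattice_add zlattice_scale)
    have "P (x, y + zscale k x)" using xy(1) by (simp add: P_def basis_pair_shear)
    then have "w (x, y) \<le> w (x, y + zscale k x)" using p(2) xy(3) by metis
    then have "B y y \<le> B (y + zscale k x) (y + zscale k x)"
      using nonneg[OF mem(1)] nonneg[OF z] by (simp add: w_def)
    also have "\<dots> = B y y + 2 * k * B x y + k * k * B x x"
      using form_comb[OF L mem, of k 1 k 1] by (simp add: zscale_one add.commute algebra_simps)
    finally show ?thesis .
  qed
  \<comment> \<open>Replacing \<open>y\<close> by \<open>y + x\<close> or \<open>y - x\<close>
    cannot shorten it, which bounds \<open>B x y\<close> on both sides.\<close>
  have red: "2 * \<bar>B x y\<bar> \<le> B x x" using shear[of 1] shear[of "-1"] by linarith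
  have "B x x \<le> B z z" if z: "z \<in> L" "z \<noteq> 0" for z
  proof -
    obtain m n where mn: "z = zscale m x + zscale n y"
      using xy(1) z(1) unfolding basis_pair_def by blast
    have "m \<noteq> 0 \<or> n \<noteq> 0" using z(2) mn by (auto simp: zscale_zero)
    from reduced_form_ge[OF red xy(2) this] show ?thesis
      using form_comb[OF L mem, of m n m n] mn by (simp add: algebra_simps)
  qed
  with xy(1) red show ?thesis using that by blast
qed

lemma zlattice_multiples:
  assumes L: "zlattice L B" and x: "x \<in> L" "x \<noteq> 0"
  shows "sublattice (range (\<lambda>k. zscale k x)) L B"
proof -
  have "zmod.independent {x}"
  proof
    assume "zmod.dependent {x}"
    then obtain k where k: "k \<noteq> 0" "zscale k x = 0" 
      using zmod.dependent_finite[of "{x}"] by auto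
    \<comment> \<open>\<open>form_comb\<close> is used with \<open>x\<close> in both places and zero
      second coefficients.\<close>
    have "k * k * B x x = 0"
      using form_comb[OF L x(1) x(1), of k 0 k 0] k(2) form_zero(1)[OF L zlattice_zero[OF L]]
      by (simp add: zscale_zero)
    moreover have "B x x > 0" using L x unfolding zlattice_def by blast
    ultimately show False using k(1) by simp
  qed
  then have "zbasis (range (\<lambda>k. zscale k x)) {x}"
    by (simp add: zbasis_def zmod.span_singleton)
  moreover have "range (\<lambda>k. zscale k x) \<subseteq> L" using zlattice_scale[OF L x(1)] by blast
  ultimately show ?thesis
    using L unfolding sublattice_def zlattice_def zlinear_on_def by (simp add: subset_iff) blast
qed

text \<open>Otherwise the multiples of \<open>x\<close> and those of \<open>y\<close> would split
  \<open>L\<close> orthogonally.\<close>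

lemma indecomposable_basis_not_orthogonal:
  assumes L: "zlattice L B" and ind: "indecomposable L B" and xy: "basis_pair L x y"
  shows "B x y \<noteq> 0"
proof
  assume b: "B x y = 0"
  let ?M = "range (\<lambda>k. zscale k x)" and ?N = "range (\<lambda>k. zscale k y)"
  have mem: "x \<in> L" "y \<in> L" using basis_pair_mem[OF xy] .
  have ind2: "m = 0 \<and> n = 0" if "zscale m x + zscale n y = 0" for m n
    using xy that unfolding basis_pair_def by blast
  have nz: "x \<noteq> 0" "y \<noteq> 0" using ind2[of 1 0] ind2[of 0 1] by (auto simp: zscale_zero)
  have in_range: "z \<in> range (\<lambda>k. zscale k z)" for z :: 'a
    by (rule range_eqI[of _ _ 1]) (simp add: zscale_one)
  have "?M \<inter> ?N = {0}"
  proof -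
    have "zscale m x = 0" if "zscale m x = zscale n y" for m n
      using ind2[of m "- n"] that by (simp add: zscale_minus zscale_zero)
    moreover have "0 \<in> ?M" "0 \<in> ?N" by (rule range_eqI[of _ _ 0], simp add: zscale_zero)+
    ultimately show ?thesis by auto
  qed
  moreover have "B u v = 0" if uv: "u \<in> ?M" "v \<in> ?N" for u v
  proof -
    obtain m n where "u = zscale m x" "v = zscale n y" using uv by blast
    then show ?thesis using form_comb[OF L mem, of m 0 0 n] b by (simp add: zscale_zero)
  qed
  moreover have "L = {u + v |u v. u \<in> ?M \<and> v \<in> ?N}"
    using xy unfolding basis_pair_def by blast
  ultimately have "orthogonal_sum L B ?M ?N" by (simp add: orthogonal_sum_def)
  moreover have "?M \<noteq> {0}" "?N \<noteq> {0}" using in_range nz by blast+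
  ultimately show False
    using ind zlattice_multiples[OF L mem(1) nz(1)] zlattice_multiples[OF L mem(2) nz(2)]
    unfolding indecomposable_def by blast
qed

section \<open>Nonrecoverability\<close>

text \<open>A change of vectors by the matrix \<open>(p, q; r, s)\<close> multiplies the Gram
  determinant by the square of the matrix determinant.\<close>

lemma gram_det_comb:
  fixes a b c p q r s :: int
  shows "(p * p * a + 2 * p * q * b + q * q * c) * (r * r * a + 2 * r * s * b + s * s * c)
      - (p * r * a + (p * s + q * r) * b + q * s * c)\<^sup>2
    = (p * s - q * r)\<^sup>2 * (a * c - b\<^sup>2)"
  by (simp add: power2_eq_square algebra_simps)

text \<open>With \<open>n\<close> the determinant of \<open>u, v\<close> in terms of
  \<open>x, y\<close>, minimality of \<open>B x x\<close> gives \<open>0 < n\<^sup>2 * D\<close> and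
  the bound on \<open>B v v\<close> gives \<open>n\<^sup>2 * D \<le> D\<close>. Hence
  \<open>n\<close> is a unit and \<open>x, y\<close> lie in \<open>M\<close>.\<close>

lemma full_sublattice:
  assumes L: "zlattice L B" and M: "sublattice M L B"
    and xy: "basis_pair L x y" "2 * \<bar>B x y\<bar> \<le> B x x" "B x y \<noteq> 0"
    and min: "\<And>z. z \<in> L \<Longrightarrow> z \<noteq> 0 \<Longrightarrow> B x x \<le> B z z"
    and u: "u \<in> M" "B u u = B x x" and v: "v \<in> M" "B u v = B x y" "B v v \<le> B y y"
  shows "M = L"
proof -
  have sub: "M \<subseteq> L" "zlattice M B" using M by (auto simp: sublattice_def)
  have mem: "x \<in> L" "y \<in> L" using basis_pair_mem[OF xy(1)] .
  have a: "0 < B x x" using xy(2,3) by linarith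
  obtain p q where pq: "u = zscale p x + zscale q y"
    using u(1) sub(1) xy(1) unfolding basis_pair_def by blast
  obtain r s where rs: "v = zscale r x + zscale s y"
    using v(1) sub(1) xy(1) unfolding basis_pair_def by blast
  define n where "n = p * s - q * r"
  define D where "D = B x x * B y y - (B x y)\<^sup>2"
  have "B u u * B v v - (B u v)\<^sup>2 = n\<^sup>2 * D"
    unfolding pq rs form_comb[OF L mem] n_def D_def
    using gram_det_comb[of p "B x x" q "B x y" "B y y" r s] by (simp add: algebra_simps)
  then have det: "B x x * B v v - (B x y)\<^sup>2 = n\<^sup>2 * D" using u(2) v(2) by simp
  \<comment> \<open>Here \<open>B x y \<noteq> 0\<close> enters: it keeps \<open>v\<close> from
    being zero, so minimality applies to it.\<close>
  have "v \<noteq> 0" using form_zero(2)[OF sub(2) u(1)] v(2) xy(3) by auto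
  then have vmin: "B x x \<le> B v v" using min v(1) sub(1) by blast
  have "(B x y)\<^sup>2 < B x x * B x x"
  proof -
    have "\<bar>B x y\<bar> < B x x" using xy(2,3) by linarith
    then have "\<bar>B x y\<bar> * \<bar>B x y\<bar> < B x x * B x x" by (intro mult_strict_mono) auto
    then show ?thesis by (simp add: power2_eq_square)
  qed
  also have "\<dots> \<le> B x x * B v v" using vmin a by simp
  finally have pos: "0 < n\<^sup>2 * D" using det by linarith
  have "B x x * B v v \<le> B x x * B y y" using v(3) a by simp
  then have le: "n\<^sup>2 * D \<le> D" using det by (simp add: D_def)
  have "0 < D" "0 < n\<^sup>2" using pos by (auto simp: zero_less_mult_iff not_less dest: order_less_le_trans)
  moreover from this have "n\<^sup>2 \<le> 1" using le by (simp add: mult_le_cancel_right1)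
  ultimately have "n\<^sup>2 = 1" by linarith
  then have nn: "n * n = 1" by (simp add: power2_eq_square)
  text \<open>Cramer's rule, with \<open>n = \<plusminus>1\<close> being its own inverse.\<close>
  have "zscale (n * s) u + zscale (- n * q) v = zscale (n * n) x + zscale 0 y"
  proof -
    have "zscale (n * s) u + zscale (- n * q) v
        = zscale (n * s * p + - n * q * r) x + zscale (n * s * q + - n * q * s) y"
      unfolding pq rs zscale_right_add zscale_mult zscale_left_add by (simp add: algebra_simps)
    then show ?thesis by (simp add: n_def algebra_simps)
  qed
  moreover have "zscale (- n * r) u + zscale (n * p) v = zscale 0 x + zscale (n * n) y"
  proof -
    have "zscale (- n * r) u + zscale (n * p) v
        = zscale (- n * r * p + n * p * r) x + zscale (- n * r * q + n * p * s) y"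
      unfolding pq rs zscale_right_add zscale_mult zscale_left_add by (simp add: algebra_simps)
    then show ?thesis by (simp add: n_def algebra_simps)
  qed
  ultimately have "x \<in> M" "y \<in> M"
    using zlattice_add[OF sub(2)] zlattice_scale[OF sub(2)] u(1) v(1) nn
    by (metis zscale_one zscale_zero add_0 add_0_right)+
  then have "L \<subseteq> M"
    using xy(1) zlattice_add[OF sub(2)] zlattice_scale[OF sub(2)] unfolding basis_pair_def by blast
  then show ?thesis using sub(1) by blast
qed

theorem proposition3p6:
  fixes L :: "'a::ab_group_add set" and B :: "'a \<Rightarrow> 'a \<Rightarrow> int"
  assumes "zlattice L B" and "zrank L = 2" and "indecomposable L B"
  shows "\<not> recoverable L B"
proof
  assume "recoverable L B"
  \<comment> \<open>The sublattices in \<open>S\<close> serve as their own indices, so the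
    orthogonal sum lives in \<open>'a set \<Rightarrow> 'a\<close>;
    \<open>recoverable_any_type\<close> carries the hypothesis over to that type.\<close>
  then obtain S where S: "finite S" "\<And>M. M \<in> S \<Longrightarrow> sublattice M L B" "\<And>M. M \<in> S \<Longrightarrow> M \<noteq> L"
    and rep: "\<And>(K :: ('a set \<Rightarrow> 'a) set) C.
      zlattice K C \<Longrightarrow> \<forall>M\<in>S. represented_by M B K C \<Longrightarrow> represented_by L B K C"
    using recoverable_any_type[where 'b = "'a set \<Rightarrow> 'a"] by metis
  obtain x y where xy: "basis_pair L x y" "2 * \<bar>B x y\<bar> \<le> B x x"
    and min: "\<And>z. z \<in> L \<Longrightarrow> z \<noteq> 0 \<Longrightarrow> B x x \<le> B z z"
    using reduced_basis[OF assms(1,2)] by blast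
  have b: "B x y \<noteq> 0" using indecomposable_basis_not_orthogonal[OF assms(1,3) xy(1)] .
  have mem: "x \<in> L" "y \<in> L" using basis_pair_mem[OF xy(1)] .
  have a: "0 < B x x" using xy(2) b by linarith
  define C where "C f g = (\<Sum>M\<in>S. B (f M) (g M))" for f g :: "'a set \<Rightarrow> 'a"
  have lat: "zlattice M B" "M \<subseteq> L" if "M \<in> S" for M
    using S(2)[OF that] by (auto simp: sublattice_def)
  have "zlattice (direct_sum S (\<lambda>M. M)) C"
    unfolding C_def using S(1) lat(1) by (rule zlattice_direct_sum)
  moreover have "\<forall>M\<in>S. represented_by M B (direct_sum S (\<lambda>M. M)) C"
    unfolding C_def using represented_by_direct_sum[of S "\<lambda>M. M" B] S(1) lat(1) by blast
  ultimately have "represented_by L B (direct_sum S (\<lambda>M. M)) C" by (rule rep)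
  then obtain \<sigma> where \<sigma>: "\<And>z. z \<in> L \<Longrightarrow> \<sigma> z \<in> direct_sum S (\<lambda>M. M)"
    "\<And>z w. z \<in> L \<Longrightarrow> w \<in> L \<Longrightarrow> C (\<sigma> z) (\<sigma> w) = B z w"
    unfolding represented_by_def by blast
  have comp: "\<sigma> z M \<in> M" "\<sigma> z M \<in> L" if "z \<in> L" "M \<in> S" for z M
    using \<sigma>(1)[OF that(1)] that(2) lat(2) by (auto simp: direct_sum_def)
  have nonneg: "0 \<le> B z z" if "z \<in> L" for z
    using form_zero(1)[OF assms(1) that] min[OF that] a by (cases "z = 0") auto
  obtain M where M: "M \<in> S" "\<sigma> x M \<noteq> 0"
  proof (rule ccontr)
    assume "\<not> thesis"
    then have "\<forall>M\<in>S. \<sigma> x M = 0" using that by blast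
    then have "C (\<sigma> x) (\<sigma> x) = 0"
      unfolding C_def using form_zero(1)[OF assms(1) zlattice_zero[OF assms(1)]] by simp
    then show False using \<sigma>(2) mem a by simp
  qed
  have split: "B z w = B (\<sigma> z M) (\<sigma> w M) + (\<Sum>N\<in>S - {M}. B (\<sigma> z N) (\<sigma> w N))"
    if "z \<in> L" "w \<in> L" for z w
    using \<sigma>(2)[OF that] S(1) M(1) by (simp add: C_def sum.remove)
  have rest: "0 \<le> B (\<sigma> z N) (\<sigma> z N)" if "z \<in> L" "N \<in> S - {M}" for z N
    using nonneg comp that by simp
  \<comment> \<open>The component in \<open>M\<close> already uses up the whole norm of
    \<open>x\<close>, which forces every other component to vanish.\<close>
  have "B x x \<le> B (\<sigma> x M) (\<sigma> x M)" using min comp mem M by blast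
  moreover have "0 \<le> (\<Sum>N\<in>S - {M}. B (\<sigma> x N) (\<sigma> x N))"
    using rest mem by (intro sum_nonneg) blast
  ultimately have u: "B (\<sigma> x M) (\<sigma> x M) = B x x"
    and "(\<Sum>N\<in>S - {M}. B (\<sigma> x N) (\<sigma> x N)) = 0"
    using split[OF mem(1) mem(1)] by linarith+
  then have "B (\<sigma> x N) (\<sigma> x N) = 0" if "N \<in> S - {M}" for N
    using sum_nonneg_eq_0_iff[of "S - {M}" "\<lambda>N. B (\<sigma> x N) (\<sigma> x N)"] rest[OF mem(1)] S(1) that
    by simp
  then have "\<sigma> x N = 0" if "N \<in> S - {M}" for N
    using min[of "\<sigma> x N"] comp[OF mem(1), of N] a that by force
  \<comment> \<open>Although \<open>y\<close> may have components outside \<open>M\<close>, they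
    pair with zero components of \<open>x\<close>, so \<open>B x y\<close> is seen in
    \<open>M\<close> alone.\<close>
  then have "(\<Sum>N\<in>S - {M}. B (\<sigma> x N) (\<sigma> y N)) = 0"
    using form_zero(1)[OF assms(1)] comp[OF mem(2)] by (intro sum.neutral) auto
  then have v: "B (\<sigma> x M) (\<sigma> y M) = B x y" using split[OF mem] by simp
  have "0 \<le> (\<Sum>N\<in>S - {M}. B (\<sigma> y N) (\<sigma> y N))"
    using rest mem by (intro sum_nonneg) blast
  then have v': "B (\<sigma> y M) (\<sigma> y M) \<le> B y y" using split[OF mem(2) mem(2)] by linarith
  have "M = L"
    using full_sublattice[OF assms(1) S(2)[OF M(1)] xy b min comp(1)[OF mem(1) M(1)] u
        comp(1)[OF mem(2) M(1)] v v'] .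
  then show False using S(3) M(1) by blast
qed

end
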